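(* Let $(\Omega,\sigma)$ be a subshift of finite type described by an $n\times n$ transition matrix $M$ with entries in $\{0,1\}$, and let $\overline{\sigma}$ be the induced map on the hyperspace $\mathcal{K}(\Omega)$ of nonempty compact subsets of $\Omega$. Then $(\Omega,\sigma)$ is topologically mixing if and only if $(\mathcal{K}(\Omega),\overline{\sigma})$ is topologically mixing.
   Context: For a $\{0,1\}$-matrix $M=(m_{ij})_{1\le i,j\le n}$, the subshift of finite type is $\Omega=\Sigma_M=\{(x_i)_{i\ge 0}\in\{1,\dots,n\}^{\mathbb{N}}: m_{x_ix_{i+1}}=1 \text{ for all } i\ge 0\}$, with $\sigma(x_0x_1x_2\ldots)=x_1x_2x_3\ldots$ and metric $D(\bar x,\bar y)=\sum_{i=0}^\infty\frac{\delta(x_i,y_i)}{2^i}$, $\delta$ the discrete metric. $\mathcal{K}(\Omega)$ carries the Hausdorff metric induced by $D$ (equivalently the Vietoris topology), and $\overline{\sigma}(K)=\sigma(K)$. A continuous $f:X\to X$ is topologically mixing if for any nonempty open $U,V\subseteq X$ there is a positive integer $k$ with $f^n(U)\cap V\neq\emptyset$ for all $n\ge k$. *)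

theory Defs
  imports "HOL-Analysis.Analysis"
begin

definition topologically_mixing :: "'a topology \<Rightarrow> ('a \<Rightarrow> 'a) \<Rightarrow> bool" where
  "topologically_mixing X f \<longleftrightarrow>
     continuous_map X X f \<and>
     (\<forall>U V. openin X U \<longrightarrow> U \<noteq> {} \<longrightarrow> openin X V \<longrightarrow> V \<noteq> {} \<longrightarrow>
        (\<exists>k>0. \<forall>m\<ge>k. (f ^^ m) ` U \<inter> V \<noteq> {}))"

definition SFT :: "nat \<Rightarrow> (nat \<Rightarrow> nat \<Rightarrow> nat) \<Rightarrow> (nat \<Rightarrow> nat) set" where
  "SFT n M = {x. (\<forall>i. x i \<in> {1..n}) \<and> (\<forall>i. M (x i) (x (Suc i)) = 1)}"

definition shift :: "(nat \<Rightarrow> 'a) \<Rightarrow> nat \<Rightarrow> 'a" where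
  "shift x = (\<lambda>i. x (Suc i))"

definition seq_dist :: "(nat \<Rightarrow> 'a) \<Rightarrow> (nat \<Rightarrow> 'a) \<Rightarrow> real" where
  "seq_dist x y = (\<Sum>i. (if x i = y i then 0 else 1) / 2 ^ i)"

definition hyperspace :: "'a topology \<Rightarrow> 'a set set" where
  "hyperspace X = {K. compactin X K \<and> K \<noteq> {}}"

text \<open>On the empty set, where real infima and suprema are unspecified, the distance is set
  to \<open>0\<close>: the locale \<open>Metric_space\<close> requires nonnegativity also outside
  the carrier.\<close>

definition hausdorff_dist :: "('a \<Rightarrow> 'a \<Rightarrow> real) \<Rightarrow> 'a set \<Rightarrow> 'a set \<Rightarrow> real" where
  "hausdorff_dist d A B =
     (if A = {} \<or> B = {} then 0
      else max (SUP a\<in>A. INF b\<in>B. d a b) (SUP b\<in>B. INF a\<in>A. d a b))"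

definition SFT_topology :: "nat \<Rightarrow> (nat \<Rightarrow> nat \<Rightarrow> nat) \<Rightarrow> (nat \<Rightarrow> nat) topology" where
  "SFT_topology n M = Metric_space.mtopology (SFT n M) seq_dist"

definition SFT_hyperspace_topology ::
    "nat \<Rightarrow> (nat \<Rightarrow> nat \<Rightarrow> nat) \<Rightarrow> (nat \<Rightarrow> nat) set topology" where
  "SFT_hyperspace_topology n M =
     Metric_space.mtopology (hyperspace (SFT_topology n M)) (hausdorff_dist seq_dist)"

text \<open>Outside the locale \<open>Metric_space\<close> the constant \<open>Metric_space.mtopology\<close> is
  unspecified, so the following facts are what gives the two topologies their meaning.\<close>

lemma seq_dist_summable:
  "summable (\<lambda>i. (if x i = y i then 0 else 1) / 2 ^ i :: real)"
proof (rule summable_comparison_test')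
  show "summable (\<lambda>i. (1/2) ^ i :: real)"
    by (rule summable_geometric) simp
qed (auto simp: power_divide)

lemma seq_dist_le: "seq_dist x y \<le> 2"
proof -
  have "seq_dist x y \<le> (\<Sum>i. (1/2) ^ i)"
    unfolding seq_dist_def
    by (intro suminf_le seq_dist_summable summable_geometric) (auto simp: power_divide)
  then show ?thesis
    by (simp add: suminf_geometric)
qed

lemma Metric_space_seq_dist: "Metric_space S seq_dist"
proof
  fix x y z :: "nat \<Rightarrow> 'a"
  show "0 \<le> seq_dist x y"
    unfolding seq_dist_def by (rule suminf_nonneg[OF seq_dist_summable]) auto
  show "seq_dist x y = seq_dist y x"
    unfolding seq_dist_def by (simp add: eq_commute)
  show "seq_dist x y = 0 \<longleftrightarrow> x = y"
    unfolding seq_dist_def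
    by (subst suminf_eq_zero_iff[OF seq_dist_summable]) (auto simp: fun_eq_iff)
  show "seq_dist x z \<le> seq_dist x y + seq_dist y z"
    unfolding seq_dist_def suminf_add[OF seq_dist_summable seq_dist_summable]
    by (intro suminf_le summable_add seq_dist_summable) (auto simp: field_simps)
qed

context
  fixes S :: "'a set" and d :: "'a \<Rightarrow> 'a \<Rightarrow> real" and c :: real
  assumes metric: "Metric_space S d" and bounded: "\<And>x y. d x y \<le> c"
begin

interpretation Metric_space S d
  by (rule metric)

lemma INF_dist_bounds:
  assumes "B \<noteq> {}"
  shows "0 \<le> (INF b\<in>B. d a b)" "(INF b\<in>B. d a b) \<le> c"
proof -
  show "0 \<le> (INF b\<in>B. d a b)"
    using assms by (intro cINF_greatest) auto
  obtain b where b: "b \<in> B"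
    using assms by blast
  have "(INF b\<in>B. d a b) \<le> d a b"
    using b by (intro cINF_lower bdd_belowI2[where m = 0]) auto
  then show "(INF b\<in>B. d a b) \<le> c"
    using bounded[of a b] by linarith
qed

lemma INF_le_hausdorff_dist:
  assumes "B \<noteq> {}" "a \<in> A"
  shows "(INF b\<in>B. d a b) \<le> hausdorff_dist d A B"
proof -
  have "(INF b\<in>B. d a b) \<le> (SUP a\<in>A. INF b\<in>B. d a b)"
    using assms INF_dist_bounds by (intro cSUP_upper bdd_aboveI2[where M = c]) auto
  then show ?thesis
    using assms unfolding hausdorff_dist_def by auto
qed

lemma hausdorff_dist_commute: "hausdorff_dist d A B = hausdorff_dist d B A"
  unfolding hausdorff_dist_def by (auto simp: commute max.commute)

lemma hausdorff_dist_nonneg: "0 \<le> hausdorff_dist d A B"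
proof (cases "A = {} \<or> B = {}")
  case True
  then show ?thesis by (auto simp: hausdorff_dist_def)
next
  case False
  then obtain a where "a \<in> A" "B \<noteq> {}" by blast
  then show ?thesis
    using INF_le_hausdorff_dist[of B a A] INF_dist_bounds(1)[of B a] by linarith
qed

lemma hausdorff_dist_le:
  assumes A: "A \<noteq> {}" and B: "B \<noteq> {}"
    and "\<And>a. a \<in> A \<Longrightarrow> (INF b\<in>B. d a b) \<le> r" and "\<And>b. b \<in> B \<Longrightarrow> (INF a\<in>A. d b a) \<le> r"
  shows "hausdorff_dist d A B \<le> r"
  unfolding hausdorff_dist_def
  using assms by (auto intro!: cSUP_least simp: commute)

lemma hausdorff_triangle_aux:
  assumes A: "A \<in> hyperspace mtopology" and B: "B \<in> hyperspace mtopology"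
    and C: "C \<in> hyperspace mtopology" and a: "a \<in> A"
  shows "(INF c\<in>C. d a c) \<le> hausdorff_dist d A B + hausdorff_dist d B C"
proof -
  have ne: "B \<noteq> {}" "C \<noteq> {}" and sub: "A \<subseteq> S" "B \<subseteq> S" "C \<subseteq> S"
    using A B C by (auto simp: hyperspace_def dest!: compactin_subset_topspace)
  have *: "(INF c\<in>C. d a c) - hausdorff_dist d B C \<le> d a b" if b: "b \<in> B" for b
  proof -
    have "(INF c\<in>C. d a c) - d a b \<le> (INF c\<in>C. d b c)"
    proof (rule cINF_greatest[OF ne(2)])
      fix c assume c: "c \<in> C"
      have "(INF c\<in>C. d a c) \<le> d a c"
        using c by (intro cINF_lower bdd_belowI2[where m = 0]) auto
      also have "\<dots> \<le> d a b + d b c"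
        using a b c sub by (intro triangle) auto
      finally show "(INF c\<in>C. d a c) - d a b \<le> d b c" by simp
    qed
    also have "\<dots> \<le> hausdorff_dist d B C"
      by (rule INF_le_hausdorff_dist[OF ne(2) b])
    finally show ?thesis by simp
  qed
  have "(INF c\<in>C. d a c) - hausdorff_dist d B C \<le> (INF b\<in>B. d a b)"
    by (rule cINF_greatest[OF ne(1) *])
  also have "\<dots> \<le> hausdorff_dist d A B"
    by (rule INF_le_hausdorff_dist[OF ne(1) a])
  finally show ?thesis by simp
qed

lemma hausdorff_zero_aux:
  assumes A: "A \<in> hyperspace mtopology" and B: "B \<in> hyperspace mtopology"
    and 0: "hausdorff_dist d A B \<le> 0"
  shows "A \<subseteq> B"
proof
  fix a assume a: "a \<in> A"
  have sub: "A \<subseteq> S" "B \<subseteq> S" and ne: "B \<noteq> {}"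
    using A B by (auto simp: hyperspace_def dest!: compactin_subset_topspace)
  have "closedin mtopology B"
    using B compactin_imp_closedin Hausdorff_space_mtopology by (auto simp: hyperspace_def)
  moreover have "a \<in> mtopology closure_of B"
    unfolding metric_closure_of
  proof (intro CollectI conjI allI impI)
    show "a \<in> S" using a sub by blast
    fix r :: real assume "r > 0"
    then have "(INF b\<in>B. d a b) < r"
      using INF_le_hausdorff_dist[OF ne a] 0 by linarith
    then obtain b where "b \<in> B" "d a b < r"
      using ne by (subst (asm) cINF_less_iff) (auto intro: bdd_belowI2[where m = 0])
    then show "\<exists>y\<in>B. y \<in> mball a r"
      using a sub by auto
  qed
  ultimately show "a \<in> B"
    by (simp add: closure_of_closedin)
qed

lemma Metric_space_hausdorff_dist:
  "Metric_space (hyperspace mtopology) (hausdorff_dist d)"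
proof
  fix A B C
  show "0 \<le> hausdorff_dist d A B"
    by (rule hausdorff_dist_nonneg)
  show "hausdorff_dist d A B = hausdorff_dist d B A"
    by (rule hausdorff_dist_commute)
  assume A: "A \<in> hyperspace mtopology" and B: "B \<in> hyperspace mtopology"
  have ne: "A \<noteq> {}" "B \<noteq> {}" and sub: "A \<subseteq> S"
    using A B by (auto simp: hyperspace_def dest!: compactin_subset_topspace)
  show "hausdorff_dist d A B = 0 \<longleftrightarrow> A = B"
  proof
    assume "hausdorff_dist d A B = 0"
    then show "A = B"
      using hausdorff_zero_aux[OF A B] hausdorff_zero_aux[OF B A] hausdorff_dist_commute[of A B]
      by auto
  next
    assume "A = B"
    have "(INF b\<in>A. d a b) \<le> 0" if "a \<in> A" for a
    proof -
      have "(INF b\<in>A. d a b) \<le> d a a"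
        using that by (intro cINF_lower bdd_belowI2[where m = 0]) auto
      also have "d a a = 0" using that sub by auto
      finally show ?thesis .
    qed
    then have "hausdorff_dist d A A \<le> 0"
      using ne by (intro hausdorff_dist_le) auto
    then show "hausdorff_dist d A B = 0"
      using \<open>A = B\<close> hausdorff_dist_nonneg[of A A] by auto
  qed
  assume C: "C \<in> hyperspace mtopology"
  then have ne': "C \<noteq> {}" by (auto simp: hyperspace_def)
  show "hausdorff_dist d A C \<le> hausdorff_dist d A B + hausdorff_dist d B C"
  proof (rule hausdorff_dist_le[OF ne(1) ne'])
    fix x assume "x \<in> C"
    then show "(INF a\<in>A. d x a) \<le> hausdorff_dist d A B + hausdorff_dist d B C"
      using hausdorff_triangle_aux[OF C B A, of x] by (simp add: hausdorff_dist_commute)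
  qed (rule hausdorff_triangle_aux[OF A B C])
qed

end

lemma Metric_space_SFT: "Metric_space (SFT n M) seq_dist"
  by (rule Metric_space_seq_dist)

lemma Metric_space_SFT_hyperspace:
  "Metric_space (hyperspace (SFT_topology n M)) (hausdorff_dist seq_dist)"
  unfolding SFT_topology_def
  by (rule Metric_space_hausdorff_dist[OF Metric_space_SFT seq_dist_le])

end

theory Submission
  imports Defs
begin

text \<open>The equivalence holds for every Lipschitz self-map of a bounded metric space. For the
  forward direction, the two given compact sets are replaced by finite nets \<open>P\<close> and \<open>Q\<close>;
  mixing, applied to the finitely many pairs of balls around \<open>p \<in> P\<close> and \<open>q \<in> Q\<close>, yields for
  all large \<open>m\<close> points \<open>z p q\<close> near \<open>p\<close> with \<open>m\<close>-th iterate near \<open>q\<close>, and the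
  finite set of all \<open>z p q\<close> is the required compact set. For the converse, mixing is applied
  to balls around singletons.\<close>

section \<open>Bounded metric spaces and estimates for the Hausdorff distance\<close>

lemma (in Metric_space) openin_mtopology_mballE:
  assumes "openin mtopology U" "x \<in> U"
  obtains r where "r > 0" "mball x r \<subseteq> U" "x \<in> M"
  using assms unfolding openin_mtopology by (meson subsetD)

text \<open>The bound keeps the suprema in \<open>hausdorff_dist\<close> from being taken over
  unbounded sets. It is required also outside \<open>S\<close>, matching the assumption of
  \<open>Metric_space_hausdorff_dist\<close>.\<close>

locale bounded_metric_space = Metric_space S d for S :: "'a set" and d +
  fixes c :: real
  assumes dist_le: "d x y \<le> c"
begin

sublocale H: Metric_space "hyperspace mtopology" "hausdorff_dist d"
  by (rule Metric_space_hausdorff_dist[OF Metric_space_axioms dist_le])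

lemma hyperspaceD:
  assumes "K \<in> hyperspace mtopology"
  shows "K \<noteq> {}" "K \<subseteq> S" "compactin mtopology K"
  using assms by (auto simp: hyperspace_def dest!: compactin_subset_topspace)

lemma finite_in_hyperspace:
  assumes "finite F" "F \<noteq> {}" "F \<subseteq> S"
  shows "F \<in> hyperspace mtopology"
  using assms by (auto simp: hyperspace_def intro!: finite_imp_compactin)

lemma INF_dist_le:
  assumes "b \<in> B"
  shows "(INF b\<in>B. d a b) \<le> d a b"
  using assms by (intro cINF_lower bdd_belowI2[where m = 0]) auto

lemma hausdorff_dist_leI:
  assumes "A \<noteq> {}" "B \<noteq> {}"
    and "\<And>a. a \<in> A \<Longrightarrow> \<exists>b\<in>B. d a b \<le> r" and "\<And>b. b \<in> B \<Longrightarrow> \<exists>a\<in>A. d b a \<le> r"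
  shows "hausdorff_dist d A B \<le> r"
proof (rule hausdorff_dist_le[OF Metric_space_axioms dist_le assms(1,2)])
  show "(INF b\<in>B. d a b) \<le> r" if "a \<in> A" for a
    using assms(3)[OF that] INF_dist_le order_trans by metis
  show "(INF a\<in>A. d b a) \<le> r" if "b \<in> B" for b
    using assms(4)[OF that] INF_dist_le order_trans by metis
qed

text \<open>A partial converse to \<open>hausdorff_dist_leI\<close>. The strict inequality is
  essential: the infimum over \<open>B\<close> need not be attained, but a value below
  \<open>r\<close> is.\<close>

lemma hausdorff_dist_lessD:
  assumes "hausdorff_dist d A B < r" "a \<in> A" "B \<noteq> {}"
  shows "\<exists>b\<in>B. d a b < r"
proof -
  have "(INF b\<in>B. d a b) < r"
    using INF_le_hausdorff_dist[OF Metric_space_axioms dist_le assms(3,2)] assms(1) by linarith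
  then show ?thesis
    using assms(3) by (subst (asm) cINF_less_iff) (auto intro: bdd_belowI2[where m = 0])
qed

text \<open>A witness within \<open>r\<close> of a point is sent by \<open>f\<close> to a witness
  within \<open>L * r\<close> of its image.\<close>

lemma hausdorff_dist_image_le:
  assumes lip: "\<And>x y. x \<in> S \<Longrightarrow> y \<in> S \<Longrightarrow> d (f x) (f y) \<le> L * d x y" and "L > 0"
    and A: "A \<noteq> {}" "A \<subseteq> S" and B: "B \<noteq> {}" "B \<subseteq> S" and less: "hausdorff_dist d A B < r"
  shows "hausdorff_dist d (f ` A) (f ` B) \<le> L * r"
proof -
  \<comment> \<open>The one-sided estimate is stated for arbitrary \<open>A'\<close> and
    \<open>B'\<close> because it is applied to both orders of the pair \<open>A\<close>,
    \<open>B\<close>.\<close>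
  have *: "\<exists>b\<in>f ` B'. d a b \<le> L * r"
    if AB: "A' \<subseteq> S" "B' \<subseteq> S" "B' \<noteq> {}" "hausdorff_dist d A' B' < r" "a \<in> f ` A'" for A' B' a
  proof -
    obtain x where x: "x \<in> A'" "a = f x" using AB(5) by blast
    obtain b where b: "b \<in> B'" "d x b < r"
      using hausdorff_dist_lessD[OF AB(4) x(1) AB(3)] by blast
    have "d a (f b) \<le> L * d x b"
      using lip x b AB by blast
    also have "\<dots> \<le> L * r"
      using b \<open>L > 0\<close> by simp
    finally show ?thesis using b by blast
  qed
  have "hausdorff_dist d B A < r"
    using less by (simp add: H.commute)
  then show ?thesis
    using assms * by (intro hausdorff_dist_leI) auto
qed

section \<open>Approximating two compact sets by a finite set and its iterate\<close>

lemma mixing_balls: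
  assumes "topologically_mixing mtopology f" "x \<in> S" "y \<in> S" "e > 0"
  shows "\<exists>k. \<forall>m\<ge>k. \<exists>z\<in>S. d x z < e \<and> d y ((f ^^ m) z) < e"
proof -
  have "x \<in> mball x e" "y \<in> mball y e"
    using assms by auto
  then have "\<exists>k>0. \<forall>m\<ge>k. (f ^^ m) ` mball x e \<inter> mball y e \<noteq> {}"
    using assms(1) openin_mball unfolding topologically_mixing_def by blast
  then show ?thesis
    by (fastforce simp: in_mball)
qed

lemma compact_finite_net:
  assumes "compactin mtopology K" "K \<noteq> {}" "e > 0"
  obtains P where "finite P" "P \<noteq> {}" "P \<subseteq> K" "\<And>a. a \<in> K \<Longrightarrow> \<exists>p\<in>P. d p a < e"
proof -
  have "\<exists>P. finite P \<and> P \<subseteq> K \<and> K \<subseteq> (\<Union>x\<in>P. mball x e)"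
    using compactin_imp_mtotally_bounded[OF assms(1)] assms(3)
    by (simp add: mtotally_bounded_def)
  then obtain P where P: "finite P" "P \<subseteq> K" "K \<subseteq> (\<Union>x\<in>P. mball x e)"
    by (elim exE conjE)
  show thesis
  proof
    show "P \<noteq> {}" using assms(2) P(3) by blast
    show "\<exists>p\<in>P. d p a < e" if "a \<in> K" for a
    proof -
      obtain p where "p \<in> P" "a \<in> mball p e" using P(3) \<open>a \<in> K\<close> by blast
      then show ?thesis by auto
    qed
  qed (rule P)+
qed

lemma funpow_image:
  fixes f :: "'b \<Rightarrow> 'b"
  shows "((`) f ^^ m) K = (f ^^ m) ` K"
  by (induction m) (auto simp: image_comp)

lemma funpow_closed:
  assumes "f \<in> S \<rightarrow> S" "x \<in> S"
  shows "(f ^^ m) x \<in> S"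
  using assms by (induction m) auto

text \<open>From \<open>K\<close> to \<open>F\<close> one passes through a net point, which costs
  \<open>e\<close> twice. From \<open>F\<close> to \<open>K\<close> a single \<open>e\<close>
  suffices, since the net lies inside \<open>K\<close>.\<close>

lemma hausdorff_dist_near_net:
  assumes "P \<noteq> {}" "P \<subseteq> K" "K \<subseteq> S" "F \<subseteq> S"
    and net: "\<And>a. a \<in> K \<Longrightarrow> \<exists>p\<in>P. d p a < e"
    and near: "\<And>p. p \<in> P \<Longrightarrow> \<exists>z\<in>F. d p z < e" "\<And>z. z \<in> F \<Longrightarrow> \<exists>p\<in>P. d p z < e"
  shows "hausdorff_dist d K F \<le> 2 * e"
proof (rule hausdorff_dist_leI)
  show "K \<noteq> {}" "F \<noteq> {}" using assms by blast+
  show "\<exists>z\<in>F. d a z \<le> 2 * e" if a: "a \<in> K" for a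
  proof -
    obtain p where p: "p \<in> P" "d p a < e" using net[OF a] by blast
    obtain z where z: "z \<in> F" "d p z < e" using near(1)[OF p(1)] by blast
    have "d a z \<le> d a p + d p z"
      using a p z assms by (intro triangle) auto
    then show ?thesis
      using p z by (intro bexI[of _ z]) (auto simp: commute[of a p])
  qed
  show "\<exists>a\<in>K. d z a \<le> 2 * e" if z: "z \<in> F" for z
  proof -
    obtain p where p: "p \<in> P" "d p z < e" using near(2)[OF z] by blast
    then have "d z p \<le> 2 * e" using nonneg[of p z] commute[of z p] by linarith
    then show ?thesis
      using p assms(2) by blast
  qed
qed

lemma mixing_hyperspace_approx:
  assumes mix: "topologically_mixing mtopology f"
    and K: "K \<in> hyperspace mtopology" and L: "L \<in> hyperspace mtopology" and "e > 0"
  shows "\<exists>k. \<forall>m\<ge>k. \<exists>F\<in>hyperspace mtopology.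
    (f ^^ m) ` F \<in> hyperspace mtopology \<and>
    hausdorff_dist d K F \<le> 2 * e \<and> hausdorff_dist d L ((f ^^ m) ` F) \<le> 2 * e"
proof -
  have f: "f \<in> S \<rightarrow> S"
    using mix continuous_map_funspace[of mtopology mtopology f]
    by (simp add: topologically_mixing_def)
  obtain P where P: "finite P" "P \<noteq> {}" "P \<subseteq> K" "\<And>a. a \<in> K \<Longrightarrow> \<exists>p\<in>P. d p a < e"
    using compact_finite_net[OF hyperspaceD(3,1)[OF K] \<open>e > 0\<close>] by blast
  obtain Q where Q: "finite Q" "Q \<noteq> {}" "Q \<subseteq> L" "\<And>a. a \<in> L \<Longrightarrow> \<exists>q\<in>Q. d q a < e"
    using compact_finite_net[OF hyperspaceD(3,1)[OF L] \<open>e > 0\<close>] by blast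
  have sub: "P \<subseteq> S" "Q \<subseteq> S"
    using P Q hyperspaceD[OF K] hyperspaceD[OF L] by auto
  have "\<forall>p\<in>P. \<forall>q\<in>Q. \<exists>k. \<forall>m\<ge>k. \<exists>z\<in>S. d p z < e \<and> d q ((f ^^ m) z) < e"
    using mixing_balls[OF mix _ _ \<open>e > 0\<close>] sub by blast
  then obtain k where k: "\<And>p q m. p \<in> P \<Longrightarrow> q \<in> Q \<Longrightarrow> m \<ge> k p q \<Longrightarrow>
      \<exists>z\<in>S. d p z < e \<and> d q ((f ^^ m) z) < e"
    by metis
  \<comment> \<open>The threshold from \<open>mixing_balls\<close> depends on the pair of centres;
    finiteness of both nets allows a common one.\<close>
  define k0 where "k0 = Max (case_prod k ` (P \<times> Q))"
  show ?thesis
  proof (intro exI[of _ k0] allI impI)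
    fix m assume m: "k0 \<le> m"
    have "k p q \<le> m" if "p \<in> P" "q \<in> Q" for p q
    proof -
      have "k p q \<le> k0"
        unfolding k0_def using that P(1) Q(1) by (intro Max_ge) (auto intro: rev_image_eqI)
      then show ?thesis using m by simp
    qed
    then have "\<forall>p\<in>P. \<forall>q\<in>Q. \<exists>z. z \<in> S \<and> d p z < e \<and> d q ((f ^^ m) z) < e"
      using k by blast
    then obtain z where z: "\<And>p q. p \<in> P \<Longrightarrow> q \<in> Q \<Longrightarrow>
        z p q \<in> S \<and> d p (z p q) < e \<and> d q ((f ^^ m) (z p q)) < e"
      by metis
    \<comment> \<open>One point for every pair: as \<open>Q\<close> is nonempty, each
      \<open>p\<close> has a point of \<open>F\<close> near it, and as \<open>P\<close> is nonempty,
      each \<open>q\<close> has a point of the image near it. So \<open>F\<close> shadows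
      \<open>P\<close> while its \<open>m\<close>-th iterate shadows \<open>Q\<close>.\<close>
    define F where "F = case_prod z ` (P \<times> Q)"
    have F: "finite F" "F \<noteq> {}" "F \<subseteq> S"
      using P Q z unfolding F_def by auto
    have fF: "finite ((f ^^ m) ` F)" "(f ^^ m) ` F \<noteq> {}" "(f ^^ m) ` F \<subseteq> S"
      using F funpow_closed[OF f] by auto
    have "hausdorff_dist d K F \<le> 2 * e"
      by (rule hausdorff_dist_near_net[OF P(2,3) hyperspaceD(2)[OF K] F(3) P(4)])
        (use z Q(2) in \<open>auto simp: F_def\<close>)
    moreover have "hausdorff_dist d L ((f ^^ m) ` F) \<le> 2 * e"
      by (rule hausdorff_dist_near_net[OF Q(2,3) hyperspaceD(2)[OF L] fF(3) Q(4)])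
        (use z P(2) in \<open>auto simp: F_def\<close>)
    ultimately show "\<exists>F\<in>hyperspace mtopology. (f ^^ m) ` F \<in> hyperspace mtopology \<and>
        hausdorff_dist d K F \<le> 2 * e \<and> hausdorff_dist d L ((f ^^ m) ` F) \<le> 2 * e"
      using finite_in_hyperspace[OF F] finite_in_hyperspace[OF fF] by blast
  qed
qed

section \<open>Continuity of the induced map, and the equivalence for Lipschitz maps\<close>

lemma continuous_map_hyperspace:
  assumes f: "continuous_map mtopology mtopology f"
    and lip: "\<And>x y. x \<in> S \<Longrightarrow> y \<in> S \<Longrightarrow> d (f x) (f y) \<le> L * d x y" and "L > 0"
  shows "continuous_map H.mtopology H.mtopology ((`) f)"
proof -
  \<comment> \<open>Continuity of \<open>f\<close> keeps images of compact sets compact; the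
    Lipschitz bound gives the \<delta> below.\<close>
  have closed: "f ` K \<in> hyperspace mtopology" if "K \<in> hyperspace mtopology" for K
    using that image_compactin[OF _ f] by (auto simp: hyperspace_def)
  show ?thesis
    unfolding H.metric_continuous_map[OF H.Metric_space_axioms]
  proof (intro conjI ballI allI impI)
    show "(`) f ` hyperspace mtopology \<subseteq> hyperspace mtopology"
      using closed by blast
    fix A and e :: real assume A: "A \<in> hyperspace mtopology" and "e > 0"
    show "\<exists>\<delta>>0. \<forall>B. B \<in> hyperspace mtopology \<and> hausdorff_dist d A B < \<delta> \<longrightarrow>
        hausdorff_dist d (f ` A) (f ` B) < e"
    \<comment> \<open>The estimate for images is only non-strict, so the factor 2 is there to end
      strictly below \<open>e\<close>.\<close>
    proof (intro exI[of _ "e / (2 * L)"] conjI allI impI)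
      show "e / (2 * L) > 0" using \<open>e > 0\<close> \<open>L > 0\<close> by simp
      fix B assume B: "B \<in> hyperspace mtopology \<and> hausdorff_dist d A B < e / (2 * L)"
      have "hausdorff_dist d (f ` A) (f ` B) \<le> L * (e / (2 * L))"
        using hausdorff_dist_image_le[OF lip \<open>L > 0\<close>] hyperspaceD[OF A] hyperspaceD[of B] B
        by blast
      also have "\<dots> < e" using \<open>e > 0\<close> \<open>L > 0\<close> by simp
      finally show "hausdorff_dist d (f ` A) (f ` B) < e" .
    qed
  qed
qed

lemma topologically_mixing_hyperspace_iff:
  assumes f: "continuous_map mtopology mtopology f"
    and lip: "\<And>x y. x \<in> S \<Longrightarrow> y \<in> S \<Longrightarrow> d (f x) (f y) \<le> L * d x y" and "L > 0"
  shows "topologically_mixing mtopology f \<longleftrightarrow> topologically_mixing H.mtopology ((`) f)"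
proof
  assume mix: "topologically_mixing mtopology f"
  show "topologically_mixing H.mtopology ((`) f)"
    unfolding topologically_mixing_def
  proof (intro conjI allI impI)
    show "continuous_map H.mtopology H.mtopology ((`) f)"
      by (rule continuous_map_hyperspace[OF assms])
    fix U V
    assume U: "openin H.mtopology U" "U \<noteq> {}" and V: "openin H.mtopology V" "V \<noteq> {}"
    then obtain K L where KL: "K \<in> U" "L \<in> V" by blast
    obtain r where r: "r > 0" "H.mball K r \<subseteq> U" and K: "K \<in> hyperspace mtopology"
      using H.openin_mtopology_mballE[OF U(1) KL(1)] .
    obtain s where s: "s > 0" "H.mball L s \<subseteq> V" and L: "L \<in> hyperspace mtopology"
      using H.openin_mtopology_mballE[OF V(1) KL(2)] .
    \<comment> \<open>A third, because the approximation is accurate only to \<open>2 * e\<close>,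
      which must stay below both radii.\<close>
    define e where "e = min r s / 3"
    have e: "e > 0" "2 * e < r" "2 * e < s"
      using r s unfolding e_def by (auto simp: min_def)
    obtain k where k: "\<And>m. m \<ge> k \<Longrightarrow> \<exists>F\<in>hyperspace mtopology.
        (f ^^ m) ` F \<in> hyperspace mtopology \<and>
        hausdorff_dist d K F \<le> 2 * e \<and> hausdorff_dist d L ((f ^^ m) ` F) \<le> 2 * e"
      using mixing_hyperspace_approx[OF mix K L e(1)] by blast
    have "((`) f ^^ m) ` U \<inter> V \<noteq> {}" if m: "m \<ge> k" for m
    proof -
      obtain F where F: "F \<in> hyperspace mtopology" "(f ^^ m) ` F \<in> hyperspace mtopology"
        "hausdorff_dist d K F \<le> 2 * e" "hausdorff_dist d L ((f ^^ m) ` F) \<le> 2 * e"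
        using k[OF m] by blast
      have "F \<in> U" "(f ^^ m) ` F \<in> V"
        using F K L e r s by (auto simp: H.in_mball subset_iff)
      then show ?thesis
        using funpow_image[of m f F] by (metis IntI empty_iff image_eqI)
    qed
    then show "\<exists>k>0. \<forall>m\<ge>k. ((`) f ^^ m) ` U \<inter> V \<noteq> {}"
      by (intro exI[of _ "Suc k"]) auto
  qed
next
  assume mix: "topologically_mixing H.mtopology ((`) f)"
  show "topologically_mixing mtopology f"
    unfolding topologically_mixing_def
  proof (intro conjI allI impI)
    show "continuous_map mtopology mtopology f" by (rule f)
    fix U V
    assume U: "openin mtopology U" "U \<noteq> {}" and V: "openin mtopology V" "V \<noteq> {}"
    then obtain x y where xy: "x \<in> U" "y \<in> V" by blast
    obtain r where r: "r > 0" "mball x r \<subseteq> U" and "x \<in> S"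
      using openin_mtopology_mballE[OF U(1) xy(1)] .
    obtain s where s: "s > 0" "mball y s \<subseteq> V" and "y \<in> S"
      using openin_mtopology_mballE[OF V(1) xy(2)] .
    have "{x} \<in> hyperspace mtopology" "{y} \<in> hyperspace mtopology"
      using \<open>x \<in> S\<close> \<open>y \<in> S\<close> by (auto intro!: finite_in_hyperspace)
    then have "{x} \<in> H.mball {x} r" "{y} \<in> H.mball {y} s"
      using r s by auto
    then obtain k where k: "k > 0"
      "\<And>m. m \<ge> k \<Longrightarrow> ((`) f ^^ m) ` H.mball {x} r \<inter> H.mball {y} s \<noteq> {}"
      using mix H.openin_mball unfolding topologically_mixing_def by blast
    have "(f ^^ m) ` U \<inter> V \<noteq> {}" if m: "m \<ge> k" for m
    proof -
      obtain K where K: "K \<in> H.mball {x} r" "(f ^^ m) ` K \<in> H.mball {y} s"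
        using k(2)[OF m] unfolding funpow_image by blast
      then have hyp: "K \<in> hyperspace mtopology" "(f ^^ m) ` K \<in> hyperspace mtopology"
        and lt: "hausdorff_dist d K {x} < r" "hausdorff_dist d ((f ^^ m) ` K) {y} < s"
        by (auto simp: H.in_mball H.commute)
      \<comment> \<open>Any point of \<open>K\<close> will do: all of \<open>K\<close> lies within
        \<open>r\<close> of \<open>x\<close>, and all of its image within \<open>s\<close> of
        \<open>y\<close>.\<close>
      obtain z where z: "z \<in> K" using hyperspaceD(1)[OF hyp(1)] by blast
      have "d z x < r" "d ((f ^^ m) z) y < s"
        using hausdorff_dist_lessD[OF lt(1) z] hausdorff_dist_lessD[OF lt(2), of "(f ^^ m) z"] z
        by auto
      moreover have "z \<in> S" "(f ^^ m) z \<in> S"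
        using z hyperspaceD(2)[OF hyp(1)] hyperspaceD(2)[OF hyp(2)] by auto
      ultimately have "z \<in> mball x r" "(f ^^ m) z \<in> mball y s"
        using \<open>x \<in> S\<close> \<open>y \<in> S\<close> by (auto simp: in_mball commute)
      then show ?thesis using r s by blast
    qed
    then show "\<exists>k>0. \<forall>m\<ge>k. (f ^^ m) ` U \<inter> V \<noteq> {}"
      using k(1) by blast
  qed
qed

end

section \<open>The shift as a Lipschitz map, and the theorem\<close>

lemma seq_dist_shift_le: "seq_dist (shift x) (shift y) \<le> 2 * seq_dist x y"
proof -
  let ?g = "\<lambda>i. (if x i = y i then 0 else 1) / 2 ^ i :: real"
  \<comment> \<open>Shifting drops the term at index 0 and doubles the weight of every other
    term.\<close>
  have "seq_dist (shift x) (shift y) = (\<Sum>i. 2 * ?g (Suc i))"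
    unfolding seq_dist_def shift_def by (intro arg_cong[of _ _ suminf] ext) auto
  also have "\<dots> = 2 * (\<Sum>i. ?g (Suc i))"
    using seq_dist_summable[of x y] by (intro suminf_mult) (subst summable_Suc_iff)
  also have "(\<Sum>i. ?g (Suc i)) = seq_dist x y - ?g 0"
    unfolding seq_dist_def by (rule suminf_split_head[OF seq_dist_summable])
  finally show ?thesis by auto
qed

lemma shift_SFT: "x \<in> SFT n M \<Longrightarrow> shift x \<in> SFT n M"
  by (auto simp: SFT_def shift_def)

lemma continuous_map_shift:
  "continuous_map (SFT_topology n M) (SFT_topology n M) shift"
  unfolding SFT_topology_def Metric_space.metric_continuous_map[OF Metric_space_SFT Metric_space_SFT]
proof (intro conjI ballI allI impI)
  show "shift ` SFT n M \<subseteq> SFT n M"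
    using shift_SFT by blast
  fix x :: "nat \<Rightarrow> nat" and e :: real assume "e > 0"
  have "seq_dist (shift x) (shift y) < e" if "seq_dist x y < e / 2" for y
    using that seq_dist_shift_le[of x y] by linarith
  then show "\<exists>\<delta>>0. \<forall>y. y \<in> SFT n M \<and> seq_dist x y < \<delta> \<longrightarrow> seq_dist (shift x) (shift y) < e"
    using \<open>e > 0\<close> by (intro exI[of _ "e / 2"]) auto
qed

theorem mainTheorem6:
  fixes n :: nat and M :: "nat \<Rightarrow> nat \<Rightarrow> nat"
  assumes "\<And>i j. i \<in> {1..n} \<Longrightarrow> j \<in> {1..n} \<Longrightarrow> M i j \<in> {0, 1}"
  shows "topologically_mixing (SFT_topology n M) shift \<longleftrightarrow>
         topologically_mixing (SFT_hyperspace_topology n M) (\<lambda>K. shift ` K)"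
proof -
  \<comment> \<open>The bound 2 is the sum of the geometric weights. Under this interpretation
    \<open>mtopology\<close> and \<open>H.mtopology\<close> are the two topologies of the
    theorem.\<close>
  interpret bounded_metric_space "SFT n M" seq_dist 2
    by (intro bounded_metric_space.intro Metric_space_SFT bounded_metric_space_axioms.intro
        seq_dist_le)
  have "continuous_map mtopology mtopology shift"
    using continuous_map_shift[of n M] by (simp add: SFT_topology_def)
  then have "topologically_mixing mtopology shift \<longleftrightarrow> topologically_mixing H.mtopology ((`) shift)"
    by (rule topologically_mixing_hyperspace_iff[where L = 2]) (auto intro: seq_dist_shift_le)
  then show ?thesis
    by (simp add: SFT_hyperspace_topology_def SFT_topology_def)
qed

end
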